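(* Let $\lambda\in P^+$ be a dominant weight of a simple Lie algebra, let $w_\lambda\in W$ be the unique shortest element with $\overline\lambda:=w_\lambda\cdot\lambda\in\mathcal O$, and fix a reduced expression $w_\lambda=s_{i_1}\cdots s_{i_m}$. For $1\le j\le m$ put $c_j=(a_{i_j},\widetilde{\lambda_{(j)}})^{-1}$ with $\lambda_{(j)}=s_{i_{j-1}}\cdots s_{i_1}\cdot\overline\lambda$, and for $J\subseteq\{1,\dots,m\}$ put $c_J=\prod_{j\in J}c_j$. Then all the constants $c_j$ and $c_J$ are positive.
   Context: Let $R_0$ be the root system of a (complex) simple Lie algebra, and let $V_0$ be the real Euclidean space spanned by $R_0$, with $W_0$-invariant inner product $(\cdot,\cdot)$. Put $\alpha^\vee=2\alpha/(\alpha,\alpha)$. Fix positive roots $R_0^+$ with simple roots $\alpha_1,\dots,\alpha_n$, and let $\beta$ be the highest short root (if all roots have the same length, all are considered short). Let $V=\mathbb R\delta\oplus V_0$ be the space of affine linear functions on $V_0$, via $(r\delta+x,y)=r+(x,y)$ for $r\in\mathbb R$, $x,y\in V_0$. Put $a_0=\delta-\beta^\vee$ and $a_i=\alpha_i^\vee$ for $1\le i\le n$; let $s_i$ be the orthogonal (affine) reflection of $V_0$ in the hyperplane $\{x: (a_i,x)=0\}$, so $s_0\cdot x=x-((\beta^\vee,x)-1)\beta$ and $s_i\cdot x=x-(\alpha_i^\vee,x)\alpha_i$ for $i\ge1$. Let $W$ be the Coxeter group generated by $s_0,\dots,s_n$ (the dual affine Weyl group) and $W_0$ the finite Weyl group generated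 by $s_1,\dots,s_n$. The length of an element of $W$ is the length of a shortest (reduced) expression in the $s_i$. $P\subset V_0$ is the weight lattice, which is preserved by $W$, and $P^+$ is the set of dominant weights. Each $W$-orbit in $P$ contains exactly one element of $\mathcal O=\{\lambda\in P: (\alpha^\vee,\lambda)\in\{0,1\}\ \text{for all }\alpha\in R_0^+\}$. For $t\in\mathbb R$ put $\varepsilon_t=1$ if $t>0$ and $\varepsilon_t=-1$ if $t\le0$. For $\lambda\in P$ put $\widetilde\lambda=\lambda+\frac12\sum_{\alpha\in R_0^+}\varepsilon_{(\alpha^\vee,\lambda)}\,\alpha$. *)

theory Defs
  imports "HOL-Analysis.Analysis"
begin

text \<open>The ambient Euclidean space \<open>V\<^sub>0\<close> is a type of class \<^class>\<open>euclidean_space\<close>, with its inner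
  product \<open>\<bullet>\<close>. Reflections are orthogonal for \<open>\<bullet>\<close>, so invariance of the inner product under the finite
  Weyl group is automatic.\<close>

definition coroot :: "'a::euclidean_space \<Rightarrow> 'a" where
  "coroot \<alpha> = (2 / (\<alpha> \<bullet> \<alpha>)) *\<^sub>R \<alpha>"

text \<open>The root systems of complex simple Lie algebras are the irreducible, reduced, crystallographic
  root systems. Since \<open>DIM('a) > 0\<close>, the spanning condition makes \<open>R\<close> nonempty.\<close>

definition root_system :: "'a::euclidean_space set \<Rightarrow> bool" where
  "root_system R \<longleftrightarrow>
     finite R \<and> 0 \<notin> R \<and> span R = UNIV \<and>
     (\<forall>\<alpha>\<in>R. \<forall>\<gamma>\<in>R. \<gamma> - (coroot \<alpha> \<bullet> \<gamma>) *\<^sub>R \<alpha> \<in> R) \<and>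
     (\<forall>\<alpha>\<in>R. \<forall>\<gamma>\<in>R. coroot \<alpha> \<bullet> \<gamma> \<in> \<int>) \<and>
     (\<forall>\<alpha>\<in>R. \<forall>c. c *\<^sub>R \<alpha> \<in> R \<longrightarrow> c = 1 \<or> c = - 1)"

definition irreducible_root_system :: "'a::euclidean_space set \<Rightarrow> bool" where
  "irreducible_root_system R \<longleftrightarrow>
     root_system R \<and>
     \<not> (\<exists>A B. A \<noteq> {} \<and> B \<noteq> {} \<and> A \<inter> B = {} \<and> A \<union> B = R \<and> (\<forall>x\<in>A. \<forall>y\<in>B. x \<bullet> y = 0))"

definition nonneg_comb :: "nat \<Rightarrow> (nat \<Rightarrow> 'a::euclidean_space) \<Rightarrow> 'a \<Rightarrow> bool" where
  "nonneg_comb n \<alpha> x \<longleftrightarrow> (\<exists>k :: nat \<Rightarrow> nat. x = (\<Sum>i=1..n. real (k i) *\<^sub>R \<alpha> i))"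

text \<open>The simple roots are enumerated as \<open>\<alpha> 1, \<dots>, \<alpha> n\<close>; values of \<open>\<alpha>\<close> elsewhere are irrelevant.\<close>

definition simple_roots :: "'a::euclidean_space set \<Rightarrow> nat \<Rightarrow> (nat \<Rightarrow> 'a) \<Rightarrow> bool" where
  "simple_roots R n \<alpha> \<longleftrightarrow>
     \<alpha> ` {1..n} \<subseteq> R \<and> inj_on \<alpha> {1..n} \<and> independent (\<alpha> ` {1..n}) \<and>
     (\<forall>\<gamma>\<in>R. nonneg_comb n \<alpha> \<gamma> \<or> nonneg_comb n \<alpha> (- \<gamma>))"

definition pos_roots :: "'a::euclidean_space set \<Rightarrow> nat \<Rightarrow> (nat \<Rightarrow> 'a) \<Rightarrow> 'a set" where
  "pos_roots R n \<alpha> = {\<gamma> \<in> R. nonneg_comb n \<alpha> \<gamma>}"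

definition short_roots :: "'a::euclidean_space set \<Rightarrow> 'a set" where
  "short_roots R = {\<gamma> \<in> R. \<forall>\<eta>\<in>R. norm \<gamma> \<le> norm \<eta>}"

definition highest_short_root ::
    "'a::euclidean_space set \<Rightarrow> nat \<Rightarrow> (nat \<Rightarrow> 'a) \<Rightarrow> 'a \<Rightarrow> bool" where
  "highest_short_root R n \<alpha> \<beta> \<longleftrightarrow>
     \<beta> \<in> short_roots R \<and> (\<forall>\<gamma>\<in>short_roots R. nonneg_comb n \<alpha> (\<beta> - \<gamma>))"

text \<open>The pair \<open>(r, x) :: real \<times> 'a\<close> represents the affine linear function \<open>r\<delta> + x\<close>.\<close>

definition aff_eval :: "real \<times> 'a::euclidean_space \<Rightarrow> 'a \<Rightarrow> real" where
  "aff_eval f y = fst f + snd f \<bullet> y"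

definition aff_delta :: "real \<times> 'a::euclidean_space" where
  "aff_delta = (1, 0)"

definition aff_simple :: "(nat \<Rightarrow> 'a::euclidean_space) \<Rightarrow> 'a \<Rightarrow> nat \<Rightarrow> real \<times> 'a" where
  "aff_simple \<alpha> \<beta> i =
     (if i = 0 then aff_delta - (0, coroot \<beta>) else (0, coroot (\<alpha> i)))"

text \<open>Orthogonal reflection in the hyperplane \<open>{x. aff_eval f x = 0}\<close>, for \<open>snd f \<noteq> 0\<close>.\<close>

definition aff_reflection :: "real \<times> 'a::euclidean_space \<Rightarrow> 'a \<Rightarrow> 'a" where
  "aff_reflection f x = x - aff_eval f x *\<^sub>R coroot (snd f)"

definition simple_refl :: "(nat \<Rightarrow> 'a::euclidean_space) \<Rightarrow> 'a \<Rightarrow> nat \<Rightarrow> 'a \<Rightarrow> 'a" where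
  "simple_refl \<alpha> \<beta> i = aff_reflection (aff_simple \<alpha> \<beta> i)"

lemma coroot_coroot: "\<alpha> \<noteq> 0 \<Longrightarrow> coroot (coroot \<alpha>) = \<alpha>"
  by (simp add: coroot_def)

lemma coroot_minus: "coroot (- \<alpha>) = - coroot \<alpha>"
  by (simp add: coroot_def)

lemma simple_refl_0:
  "\<beta> \<noteq> 0 \<Longrightarrow> simple_refl \<alpha> \<beta> 0 x = x - (coroot \<beta> \<bullet> x - 1) *\<^sub>R \<beta>"
  by (simp add: simple_refl_def aff_reflection_def aff_simple_def aff_delta_def aff_eval_def
      coroot_minus coroot_coroot algebra_simps)

lemma simple_refl_pos:
  "i \<noteq> 0 \<Longrightarrow> \<alpha> i \<noteq> 0 \<Longrightarrow> simple_refl \<alpha> \<beta> i x = x - (coroot (\<alpha> i) \<bullet> x) *\<^sub>R \<alpha> i"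
  by (simp add: simple_refl_def aff_reflection_def aff_simple_def aff_eval_def coroot_coroot)

text \<open>\<open>word_map \<alpha> \<beta> [i\<^sub>1, \<dots>, i\<^sub>m]\<close> is the composition \<open>s\<^bsub>i\<^sub>1\<^esub> \<circ> \<dots> \<circ> s\<^bsub>i\<^sub>m\<^esub>\<close>, so the last letter acts first.\<close>

definition word_map :: "(nat \<Rightarrow> 'a::euclidean_space) \<Rightarrow> 'a \<Rightarrow> nat list \<Rightarrow> 'a \<Rightarrow> 'a" where
  "word_map \<alpha> \<beta> is = foldr (\<lambda>i f. simple_refl \<alpha> \<beta> i \<circ> f) is id"

text \<open>The group generated by the \<open>s\<^sub>i\<close>, \<open>0 \<le> i \<le> n\<close>, as transformations of the ambient space; the
  generators are involutions, so no inverses of letters are needed.\<close>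

definition dual_affine_weyl :: "nat \<Rightarrow> (nat \<Rightarrow> 'a::euclidean_space) \<Rightarrow> 'a \<Rightarrow> ('a \<Rightarrow> 'a) set" where
  "dual_affine_weyl n \<alpha> \<beta> = {word_map \<alpha> \<beta> is | is. set is \<subseteq> {0..n}}"

definition weyl_length ::
    "nat \<Rightarrow> (nat \<Rightarrow> 'a::euclidean_space) \<Rightarrow> 'a \<Rightarrow> ('a \<Rightarrow> 'a) \<Rightarrow> nat" where
  "weyl_length n \<alpha> \<beta> w =
     (LEAST m. \<exists>is. set is \<subseteq> {0..n} \<and> word_map \<alpha> \<beta> is = w \<and> length is = m)"

definition reduced_expression ::
    "nat \<Rightarrow> (nat \<Rightarrow> 'a::euclidean_space) \<Rightarrow> 'a \<Rightarrow> nat list \<Rightarrow> ('a \<Rightarrow> 'a) \<Rightarrow> bool" where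
  "reduced_expression n \<alpha> \<beta> is w \<longleftrightarrow>
     set is \<subseteq> {0..n} \<and> word_map \<alpha> \<beta> is = w \<and> length is = weyl_length n \<alpha> \<beta> w"

definition weight_lattice :: "'a::euclidean_space set \<Rightarrow> 'a set" where
  "weight_lattice R = {l. \<forall>\<gamma>\<in>R. coroot \<gamma> \<bullet> l \<in> \<int>}"

definition dominant_weights :: "'a::euclidean_space set \<Rightarrow> nat \<Rightarrow> (nat \<Rightarrow> 'a) \<Rightarrow> 'a set" where
  "dominant_weights R n \<alpha> = {l \<in> weight_lattice R. \<forall>i\<in>{1..n}. coroot (\<alpha> i) \<bullet> l \<ge> 0}"

text \<open>The set \<open>\<O>\<close> of representatives of the orbits on the weight lattice; it contains \<open>0\<close>.\<close>

definition minuscule_weights :: "'a::euclidean_space set \<Rightarrow> nat \<Rightarrow> (nat \<Rightarrow> 'a) \<Rightarrow> 'a set" where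
  "minuscule_weights R n \<alpha> =
     {l \<in> weight_lattice R. \<forall>\<gamma>\<in>pos_roots R n \<alpha>. coroot \<gamma> \<bullet> l \<in> {0, 1}}"

text \<open>\<open>w\<close> is an element of minimal length among those carrying \<open>l\<close> into
  \<open>\<O>\<close>. Such a \<open>w\<close> is in fact
  unique; uniqueness is not built into the definition.\<close>

definition shortest_to_minuscule ::
    "'a::euclidean_space set \<Rightarrow> nat \<Rightarrow> (nat \<Rightarrow> 'a) \<Rightarrow> 'a \<Rightarrow> 'a \<Rightarrow> ('a \<Rightarrow> 'a) \<Rightarrow> bool" where
  "shortest_to_minuscule R n \<alpha> \<beta> l w \<longleftrightarrow>
     w \<in> dual_affine_weyl n \<alpha> \<beta> \<and> w l \<in> minuscule_weights R n \<alpha> \<and>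
     (\<forall>v\<in>dual_affine_weyl n \<alpha> \<beta>.
        v l \<in> minuscule_weights R n \<alpha> \<longrightarrow> weyl_length n \<alpha> \<beta> w \<le> weyl_length n \<alpha> \<beta> v)"

definition eps :: "real \<Rightarrow> real" where
  "eps t = (if t > 0 then 1 else - 1)"

definition weight_tilde ::
    "'a::euclidean_space set \<Rightarrow> nat \<Rightarrow> (nat \<Rightarrow> 'a) \<Rightarrow> 'a \<Rightarrow> 'a" where
  "weight_tilde R n \<alpha> l =
     l + (1 / 2) *\<^sub>R (\<Sum>\<gamma>\<in>pos_roots R n \<alpha>. eps (coroot \<gamma> \<bullet> l) *\<^sub>R \<gamma>)"

text \<open>\<open>step_weight \<alpha> \<beta> [i\<^sub>1, \<dots>, i\<^sub>m] \<mu> j\<close> is \<open>s\<^bsub>i\<^sub>j\<^sub>-\<^sub>1\<^esub> \<cdots> s\<^bsub>i\<^sub>1\<^esub> \<mu>\<close>. The index \<open>j\<close> counts from 1, list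
  positions from 0.\<close>

definition step_weight ::
    "(nat \<Rightarrow> 'a::euclidean_space) \<Rightarrow> 'a \<Rightarrow> nat list \<Rightarrow> 'a \<Rightarrow> nat \<Rightarrow> 'a" where
  "step_weight \<alpha> \<beta> is \<mu> j = word_map \<alpha> \<beta> (rev (take (j - 1) is)) \<mu>"

definition step_const ::
    "'a::euclidean_space set \<Rightarrow> nat \<Rightarrow> (nat \<Rightarrow> 'a) \<Rightarrow> 'a \<Rightarrow> nat list \<Rightarrow> 'a \<Rightarrow> nat \<Rightarrow> real" where
  "step_const R n \<alpha> \<beta> is \<mu> j =
     inverse (aff_eval (aff_simple \<alpha> \<beta> (is ! (j - 1)))
       (weight_tilde R n \<alpha> (step_weight \<alpha> \<beta> is \<mu> j)))"

end

theory Submission imports Defs begin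

text \<open>Encode the affine coroots as pairs \<open>(r, coroot \<gamma>)\<close> with \<open>r\<close> an integer, positive if
  \<open>r > 0\<close>, or \<open>r = 0\<close> and \<open>\<gamma>\<close> is a positive root. Since \<open>\<beta>\<close> is the highest short root,
  each \<open>s\<^sub>i\<close> permutes the positive affine coroots other than \<open>a\<^sub>i\<close>, and all of them are nonnegative
  on \<open>\<O>\<close>. An exchange argument then shows that the path from \<open>\<O>\<close> to the weight
  given by a shortest word only crosses hyperplanes from their positive side:
  \<open>a\<^bsub>i\<^sub>j\<^esub>\<close> is positive at the \<open>j\<close>-th weight. The correction that turns a weight \<open>\<lambda>\<close> into
  \<open>weight_tilde\<close> is half a sum of \<open>\<epsilon>\<^sub>\<gamma> \<gamma>\<close> over all positive \<open>\<gamma>\<close>; extending \<open>\<epsilon>\<close> to an odd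
  function on all roots and averaging over a reflection shows that it only increases
  \<open>a\<^bsub>i\<^sub>j\<^esub>\<close>.\<close>

section \<open>Reflections of vectors and of affine functions\<close>

definition root_refl :: "'a::euclidean_space \<Rightarrow> 'a \<Rightarrow> 'a" where
  "root_refl \<theta> x = x - (coroot \<theta> \<bullet> x) *\<^sub>R \<theta>"

text \<open>This is f composed with \<open>aff_reflection h\<close>, as
  \<open>aff_eval_refl_fun\<close> confirms; on linear parts it acts as
  \<open>root_refl (snd h)\<close>.\<close>

definition aff_refl_fun :: "real \<times> 'a::euclidean_space \<Rightarrow> real \<times> 'a \<Rightarrow> real \<times> 'a" where
  "aff_refl_fun h f = f - (snd f \<bullet> coroot (snd h)) *\<^sub>R h"

lemma root_refl_invol: "\<theta> \<noteq> 0 \<Longrightarrow> root_refl \<theta> (root_refl \<theta> x) = x"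
  by (simp add: root_refl_def coroot_def inner_diff_right algebra_simps)

lemma root_refl_inner_same: "\<theta> \<noteq> 0 \<Longrightarrow> root_refl \<theta> x \<bullet> root_refl \<theta> x = x \<bullet> x"
  by (simp add: root_refl_def coroot_def inner_diff_right inner_diff_left inner_commute field_simps)

lemma coroot_root_refl:
  assumes "\<theta> \<noteq> 0"
  shows "coroot (root_refl \<theta> x) = coroot x - (coroot x \<bullet> \<theta>) *\<^sub>R coroot \<theta>"
proof -
  have "coroot (root_refl \<theta> x) = (2 / (x \<bullet> x)) *\<^sub>R root_refl \<theta> x"
    using assms by (simp add: coroot_def root_refl_inner_same)
  then show ?thesis
    by (simp add: root_refl_def coroot_def algebra_simps inner_commute)
qed

lemma coroot_inner_root_refl:
  "\<theta> \<noteq> 0 \<Longrightarrow> coroot \<theta> \<bullet> root_refl \<theta> x = - (coroot \<theta> \<bullet> x)"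
  by (simp add: root_refl_def coroot_def inner_diff_right field_simps)

lemma coroot_inner_self: "\<theta> \<noteq> 0 \<Longrightarrow> coroot \<theta> \<bullet> \<theta> = 2"
  by (simp add: coroot_def)

lemma coroot_inner_pos_iff:
  assumes "\<theta> \<noteq> 0" "\<gamma> \<noteq> 0"
  shows "coroot \<theta> \<bullet> \<gamma> > 0 \<longleftrightarrow> coroot \<gamma> \<bullet> \<theta> > 0"
proof -
  have *: "coroot x \<bullet> y > 0 \<longleftrightarrow> x \<bullet> y > 0" if "x \<noteq> 0" for x y :: 'a
  proof -
    have "2 / (x \<bullet> x) > 0" using that by simp
    then show ?thesis
      unfolding coroot_def inner_scaleR_left by (metis mult_pos_pos zero_less_mult_pos)
  qed
  show ?thesis using *[OF assms(1)] *[OF assms(2)] by (simp add: inner_commute)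
qed

lemma aff_eval_refl_fun: "aff_eval (aff_refl_fun h f) x = aff_eval f (aff_reflection h x)"
  by (simp add: aff_eval_def aff_refl_fun_def aff_reflection_def inner_diff_left inner_diff_right
      algebra_simps)

lemma aff_eval_aff_reflection:
  "snd h \<noteq> 0 \<Longrightarrow> aff_eval h (aff_reflection h x) = - aff_eval h x"
  by (simp add: aff_eval_def aff_reflection_def coroot_def inner_diff_right divide_simps)

lemma aff_reflection_invol:
  "snd h \<noteq> 0 \<Longrightarrow> aff_reflection h (aff_reflection h x) = x"
  using aff_eval_aff_reflection[of h x] by (simp add: aff_reflection_def)

text \<open>Lets \<open>exchange\<close> carry a wall past one letter of a word: the reflection in h
  maps the wall of f to the wall of \<open>aff_refl_fun h f\<close>.\<close>

lemma aff_reflection_conj: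
  assumes "snd h \<noteq> 0"
  shows "aff_reflection (aff_refl_fun h f) (aff_reflection h x)
    = aff_reflection h (aff_reflection f x)"
proof -
  have eval: "aff_eval (aff_refl_fun h f) (aff_reflection h x) = aff_eval f x"
    using assms by (simp add: aff_eval_refl_fun aff_reflection_invol)
  have "snd (aff_refl_fun h f) = root_refl (snd h) (snd f)"
    by (simp add: aff_refl_fun_def root_refl_def coroot_def inner_commute)
  then have "coroot (snd (aff_refl_fun h f))
      = coroot (snd f) - (coroot (snd f) \<bullet> snd h) *\<^sub>R coroot (snd h)"
    using assms by (simp add: coroot_root_refl)
  then have "aff_reflection (aff_refl_fun h f) (aff_reflection h x)
      = aff_reflection h x - aff_eval f x *\<^sub>R
          (coroot (snd f) - (coroot (snd f) \<bullet> snd h) *\<^sub>R coroot (snd h))"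
    using eval by (simp add: aff_reflection_def[of "aff_refl_fun h f"])
  also have "\<dots> = aff_reflection h (aff_reflection f x)"
    by (simp add: aff_reflection_def aff_eval_def inner_diff_right inner_commute algebra_simps)
  finally show ?thesis .
qed

section \<open>Words in the generators and nonnegative combinations\<close>

lemma word_map_append: "word_map \<alpha> \<beta> (u @ v) x = word_map \<alpha> \<beta> u (word_map \<alpha> \<beta> v x)"
  by (induction u) (simp_all add: word_map_def)

lemma word_map_Cons: "word_map \<alpha> \<beta> (i # u) x = simple_refl \<alpha> \<beta> i (word_map \<alpha> \<beta> u x)"
  by (simp add: word_map_def)

lemma word_map_Nil: "word_map \<alpha> \<beta> [] x = x"
  by (simp add: word_map_def)

lemma eps_cases: "eps t = 1 \<or> eps t = - 1"
  by (simp add: eps_def)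

lemma nonneg_comb_add:
  assumes "nonneg_comb n \<alpha> x" "nonneg_comb n \<alpha> y"
  shows "nonneg_comb n \<alpha> (x + y)"
proof -
  obtain k k' where "x = (\<Sum>i=1..n. real (k i) *\<^sub>R \<alpha> i)" "y = (\<Sum>i=1..n. real (k' i) *\<^sub>R \<alpha> i)"
    using assms by (auto simp: nonneg_comb_def)
  then have "x + y = (\<Sum>i=1..n. real (k i + k' i) *\<^sub>R \<alpha> i)"
    by (simp add: sum.distrib scaleR_add_left)
  then show ?thesis unfolding nonneg_comb_def by (intro exI[of _ "\<lambda>i. k i + k' i"])
qed

lemma nonneg_comb_mult:
  assumes "nonneg_comb n \<alpha> x"
  shows "nonneg_comb n \<alpha> (real m *\<^sub>R x)"
proof -
  obtain k where "x = (\<Sum>i=1..n. real (k i) *\<^sub>R \<alpha> i)"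
    using assms by (auto simp: nonneg_comb_def)
  then have "real m *\<^sub>R x = (\<Sum>i=1..n. real (m * k i) *\<^sub>R \<alpha> i)"
    by (simp add: scaleR_sum_right)
  then show ?thesis unfolding nonneg_comb_def by (intro exI[of _ "\<lambda>i. m * k i"])
qed

section \<open>Positive roots of a root system with a base\<close>

locale based_root_system =
  fixes R :: "'a::euclidean_space set" and n :: nat and \<alpha> :: "nat \<Rightarrow> 'a"
  assumes root_system: "root_system R"
    and simple: "simple_roots R n \<alpha>"
begin

abbreviation "Pos \<equiv> pos_roots R n \<alpha>"

lemma finite_roots: "finite R"
  and root_nonzero: "\<gamma> \<in> R \<Longrightarrow> \<gamma> \<noteq> 0"
  and root_refl_root: "\<theta> \<in> R \<Longrightarrow> \<gamma> \<in> R \<Longrightarrow> root_refl \<theta> \<gamma> \<in> R"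
  and coroot_inner_Ints: "\<theta> \<in> R \<Longrightarrow> \<gamma> \<in> R \<Longrightarrow> coroot \<theta> \<bullet> \<gamma> \<in> \<int>"
  and root_multiple: "\<gamma> \<in> R \<Longrightarrow> c *\<^sub>R \<gamma> \<in> R \<Longrightarrow> c = 1 \<or> c = - 1"
  using root_system unfolding root_system_def root_refl_def by blast+

lemma simple_root: "i \<in> {1..n} \<Longrightarrow> \<alpha> i \<in> R"
  using simple unfolding simple_roots_def by blast

lemma uminus_root: "\<gamma> \<in> R \<Longrightarrow> - \<gamma> \<in> R"
  using root_refl_root[of \<gamma> \<gamma>] root_nonzero[of \<gamma>]
  by (simp add: root_refl_def coroot_inner_self algebra_simps scaleR_2)

lemma simple_coeffs_zero:
  assumes "(\<Sum>i=1..n. c i *\<^sub>R \<alpha> i) = 0" "i \<in> {1..n}"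
  shows "c i = 0"
proof -
  have inj: "inj_on \<alpha> {1..n}" and ind: "independent (\<alpha> ` {1..n})"
    using simple by (auto simp: simple_roots_def)
  \<comment> \<open>\<open>independentD\<close> wants coefficients indexed by vectors, so c is
    transported along the inverse of the injective enumeration.\<close>
  define d where "d = c \<circ> the_inv_into {1..n} \<alpha>"
  have "(\<Sum>v\<in>\<alpha> ` {1..n}. d v *\<^sub>R v) = (\<Sum>i=1..n. c i *\<^sub>R \<alpha> i)"
    using inj by (simp add: sum.reindex d_def the_inv_into_f_f)
  then have "d (\<alpha> i) = 0"
    using ind assms independentD[OF ind, of "\<alpha> ` {1..n}" d "\<alpha> i"] by auto
  then show ?thesis using inj assms(2) by (simp add: d_def the_inv_into_f_f)
qed

text \<open>Adding the two combinations gives a relation among independent vectors with coefficients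
  \<open>k i + k' i\<close>; natural numbers with sum zero are zero.\<close>

lemma nonneg_comb_antisym:
  assumes "nonneg_comb n \<alpha> x" "nonneg_comb n \<alpha> (- x)"
  shows "x = 0"
proof -
  obtain k k' where k: "x = (\<Sum>i=1..n. real (k i) *\<^sub>R \<alpha> i)"
    and k': "- x = (\<Sum>i=1..n. real (k' i) *\<^sub>R \<alpha> i)"
    using assms by (auto simp: nonneg_comb_def)
  have "(\<Sum>i=1..n. real (k i + k' i) *\<^sub>R \<alpha> i) = x + - x"
    by (simp only: k' k[symmetric] sum.distrib of_nat_add scaleR_add_left)
  then have "(\<Sum>i=1..n. real (k i + k' i) *\<^sub>R \<alpha> i) = 0" by simp
  then have "real (k i + k' i) = 0" if "i \<in> {1..n}" for i
    using simple_coeffs_zero[of "\<lambda>i. real (k i + k' i)"] that by blast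
  then have "k i = 0" if "i \<in> {1..n}" for i using that by force
  then show ?thesis unfolding k by (intro sum.neutral) simp
qed

lemma not_pos_iff: "\<gamma> \<in> R \<Longrightarrow> \<gamma> \<notin> Pos \<longleftrightarrow> - \<gamma> \<in> Pos"
  using simple nonneg_comb_antisym[of \<gamma>] root_nonzero[of \<gamma>] uminus_root[of \<gamma>]
  unfolding simple_roots_def pos_roots_def by auto

lemma simple_root_pos:
  assumes "i \<in> {1..n}"
  shows "\<alpha> i \<in> Pos"
proof -
  have "\<alpha> i = (\<Sum>j=1..n. real (if j = i then 1 else 0) *\<^sub>R \<alpha> j)"
    using assms by (simp add: if_distrib[of real] if_distrib[of "\<lambda>c. c *\<^sub>R _"] cong: if_cong)
  then show ?thesis
    using simple_root[OF assms] unfolding pos_roots_def nonneg_comb_def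
    by (intro CollectI conjI exI[of _ "\<lambda>j. if j = i then 1 else 0"])
qed

text \<open>The reflection changes only the coefficient at \<open>\<alpha> i\<close>. If the image
  were negative, all other coefficients of \<gamma> would vanish, and since R is reduced, \<gamma>
  would be \<open>\<alpha> i\<close> itself.\<close>

lemma simple_refl_pos_root:
  assumes i: "i \<in> {1..n}" and \<gamma>: "\<gamma> \<in> Pos" "\<gamma> \<noteq> \<alpha> i"
  shows "root_refl (\<alpha> i) \<gamma> \<in> Pos"
proof (rule ccontr)
  assume "root_refl (\<alpha> i) \<gamma> \<notin> Pos"
  moreover have R: "\<gamma> \<in> R" using \<gamma> by (simp add: pos_roots_def)
  ultimately have neg: "- root_refl (\<alpha> i) \<gamma> \<in> Pos"
    using root_refl_root simple_root[OF i] not_pos_iff by blast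
  define p where "p = coroot (\<alpha> i) \<bullet> \<gamma>"
  obtain k k' where k: "\<gamma> = (\<Sum>j=1..n. real (k j) *\<^sub>R \<alpha> j)"
    and k': "- root_refl (\<alpha> i) \<gamma> = (\<Sum>j=1..n. real (k' j) *\<^sub>R \<alpha> j)"
    using \<gamma>(1) neg by (auto simp: pos_roots_def nonneg_comb_def)
  have p: "(\<Sum>j=1..n. (if j = i then p else 0) *\<^sub>R \<alpha> j) = p *\<^sub>R \<alpha> i"
    using i by (simp add: if_distrib[of "\<lambda>c. c *\<^sub>R _"] cong: if_cong)
  have "(\<Sum>j=1..n. (real (k j) + real (k' j) - (if j = i then p else 0)) *\<^sub>R \<alpha> j)
      = \<gamma> + - root_refl (\<alpha> i) \<gamma> - p *\<^sub>R \<alpha> i"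
    by (simp only: k' k[symmetric] p[symmetric] sum.distrib sum_subtractf scaleR_add_left
        scaleR_diff_left)
  also have "\<dots> = 0" by (simp add: root_refl_def p_def)
  finally have "real (k j) + real (k' j) - (if j = i then p else 0) = 0" if "j \<in> {1..n}" for j
    using simple_coeffs_zero[of "\<lambda>j. real (k j) + real (k' j) - (if j = i then p else 0)"] that
    by blast
  then have "k j = 0" if "j \<in> {1..n}" "j \<noteq> i" for j
    using that by fastforce
  then have "\<gamma> = (\<Sum>j=1..n. if j = i then real (k i) *\<^sub>R \<alpha> i else 0)"
    unfolding k by (intro sum.cong) auto
  then have *: "\<gamma> = real (k i) *\<^sub>R \<alpha> i" using i by simp
  then have "real (k i) = 1 \<or> real (k i) = - 1"
    using root_multiple[OF simple_root[OF i]] R by metis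
  then show False using * \<gamma>(2) by auto
qed

lemma minuscule_pairing_bounds:
  assumes "\<mu> \<in> minuscule_weights R n \<alpha>" "\<gamma> \<in> R"
  shows "coroot \<gamma> \<bullet> \<mu> \<ge> - 1" "\<gamma> \<in> Pos \<Longrightarrow> coroot \<gamma> \<bullet> \<mu> \<ge> 0"
proof -
  have val: "coroot \<eta> \<bullet> \<mu> = 0 \<or> coroot \<eta> \<bullet> \<mu> = 1" if "\<eta> \<in> Pos" for \<eta>
    using assms(1) that by (auto simp: minuscule_weights_def)
  show "coroot \<gamma> \<bullet> \<mu> \<ge> 0" if "\<gamma> \<in> Pos" using val[OF that] by auto
  show "coroot \<gamma> \<bullet> \<mu> \<ge> - 1"
  proof (cases "\<gamma> \<in> Pos")
    case True
    then show ?thesis using val by fastforce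
  next
    case False
    then show ?thesis
      using val[of "- \<gamma>"] not_pos_iff[OF assms(2)] by (auto simp: coroot_minus)
  qed
qed

section \<open>Signs of roots and the shift to \<open>weight_tilde\<close>\<close>

definition root_eps :: "'a \<Rightarrow> 'a \<Rightarrow> real" where
  "root_eps l \<gamma> = (if \<gamma> \<in> Pos then eps (coroot \<gamma> \<bullet> l) else - eps (coroot (- \<gamma>) \<bullet> l))"

lemma root_eps_uminus: "\<gamma> \<in> R \<Longrightarrow> root_eps l (- \<gamma>) = - root_eps l \<gamma>"
  using not_pos_iff[of \<gamma>] by (auto simp: root_eps_def)

lemma root_eps_cases: "root_eps l \<gamma> = 1 \<or> root_eps l \<gamma> = - 1"
  using eps_cases by (auto simp: root_eps_def)

text \<open>\<open>eps\<close> is -1 at 0, so among the roots orthogonal to l the sign 1 falls on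
  the negative ones. This tie rule decides the affine case of
  \<open>aff_simple_tilde_pos\<close>.\<close>

lemma root_eps_eq_1_iff:
  "root_eps l \<gamma> = 1 \<longleftrightarrow> coroot \<gamma> \<bullet> l > 0 \<or> (coroot \<gamma> \<bullet> l = 0 \<and> \<gamma> \<notin> Pos)"
  by (auto simp: root_eps_def eps_def coroot_minus)

lemma sum_roots_eq_twice_sum_pos:
  fixes g :: "'a \<Rightarrow> real"
  assumes "\<And>\<gamma>. \<gamma> \<in> R \<Longrightarrow> g (- \<gamma>) = g \<gamma>"
  shows "(\<Sum>\<gamma>\<in>R. g \<gamma>) = 2 * (\<Sum>\<gamma>\<in>Pos. g \<gamma>)"
proof -
  have "Pos \<subseteq> R" by (auto simp: pos_roots_def)
  have neg: "R - Pos = uminus ` Pos"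
  proof
    show "R - Pos \<subseteq> uminus ` Pos"
      using not_pos_iff by (metis DiffD1 DiffD2 add.inverse_inverse image_eqI subsetI)
    show "uminus ` Pos \<subseteq> R - Pos"
      using not_pos_iff uminus_root \<open>Pos \<subseteq> R\<close> by auto
  qed
  have "(\<Sum>\<gamma>\<in>R. g \<gamma>) = (\<Sum>\<gamma>\<in>uminus ` Pos. g \<gamma>) + (\<Sum>\<gamma>\<in>Pos. g \<gamma>)"
    using sum.subset_diff[OF \<open>Pos \<subseteq> R\<close> finite_roots, of g] neg by simp
  also have "(\<Sum>\<gamma>\<in>uminus ` Pos. g \<gamma>) = (\<Sum>\<gamma>\<in>Pos. g \<gamma>)"
    using assms \<open>Pos \<subseteq> R\<close> by (subst sum.reindex) (auto intro!: sum.cong)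
  finally show ?thesis by simp
qed

text \<open>Sign times pairing is even in \<gamma>, so the sum over \<open>Pos\<close> is half the
  sum over R. Reindexing by the reflection in \<theta> negates the pairing; adding both forms leaves
  a sum of products of a sign difference and a pairing, and by \<open>mono\<close> these factors
  never have opposite signs.\<close>

lemma coroot_inner_eps_sum_nonneg:
  assumes \<theta>: "\<theta> \<in> R"
    and mono: "\<And>\<gamma>. \<gamma> \<in> R \<Longrightarrow> coroot \<theta> \<bullet> \<gamma> > 0 \<Longrightarrow> root_eps l (root_refl \<theta> \<gamma>) = 1 \<Longrightarrow> root_eps l \<gamma> = 1"
  shows "coroot \<theta> \<bullet> (\<Sum>\<gamma>\<in>Pos. eps (coroot \<gamma> \<bullet> l) *\<^sub>R \<gamma>) \<ge> 0"
proof -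
  define e where "e = root_eps l"
  have \<theta>0: "\<theta> \<noteq> 0" using \<theta> root_nonzero by blast
  have le: "e (root_refl \<theta> \<gamma>) \<le> e \<gamma>" if "\<gamma> \<in> R" "coroot \<theta> \<bullet> \<gamma> > 0" for \<gamma>
    using mono[OF that] root_eps_cases[of l \<gamma>] root_eps_cases[of l "root_refl \<theta> \<gamma>"]
    unfolding e_def by fastforce
  have pair_nonneg: "0 \<le> (e \<gamma> - e (root_refl \<theta> \<gamma>)) * (coroot \<theta> \<bullet> \<gamma>)" if "\<gamma> \<in> R" for \<gamma>
  proof -
    consider "coroot \<theta> \<bullet> \<gamma> > 0" | "coroot \<theta> \<bullet> \<gamma> = 0" | "coroot \<theta> \<bullet> \<gamma> < 0" by linarith
    then show ?thesis
    proof cases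
      case 1
      then show ?thesis using le[OF that] by simp
    next
      case 2
      then show ?thesis by simp
    next
      case 3
      \<comment> \<open>Here \<open>root_refl \<theta> \<gamma>\<close> has positive pairing, and
        reflecting it again returns \<gamma>.\<close>
      have "e \<gamma> \<le> e (root_refl \<theta> \<gamma>)"
        using 3 le[OF root_refl_root[OF \<theta> that]] \<theta>0
        by (simp add: root_refl_invol coroot_inner_root_refl)
      then show ?thesis using 3 by (simp add: mult_nonpos_nonpos)
    qed
  qed
  have bij: "bij_betw (root_refl \<theta>) R R"
    by (rule bij_betwI[of _ _ _ "root_refl \<theta>"])
      (use \<theta> \<theta>0 root_refl_root root_refl_invol in auto)
  have "(\<Sum>\<gamma>\<in>R. e \<gamma> * (coroot \<theta> \<bullet> \<gamma>))
      = (\<Sum>\<gamma>\<in>R. e (root_refl \<theta> \<gamma>) * (coroot \<theta> \<bullet> root_refl \<theta> \<gamma>))"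
    using sum.reindex_bij_betw[OF bij, of "\<lambda>\<gamma>. e \<gamma> * (coroot \<theta> \<bullet> \<gamma>)"] by simp
  also have "\<dots> = - (\<Sum>\<gamma>\<in>R. e (root_refl \<theta> \<gamma>) * (coroot \<theta> \<bullet> \<gamma>))"
    using \<theta>0 by (simp add: coroot_inner_root_refl sum_negf)
  finally have "2 * (\<Sum>\<gamma>\<in>R. e \<gamma> * (coroot \<theta> \<bullet> \<gamma>))
      = (\<Sum>\<gamma>\<in>R. (e \<gamma> - e (root_refl \<theta> \<gamma>)) * (coroot \<theta> \<bullet> \<gamma>))"
    by (simp add: left_diff_distrib sum_subtractf)
  also have "\<dots> \<ge> 0" using pair_nonneg by (intro sum_nonneg)
  finally have "(\<Sum>\<gamma>\<in>R. e \<gamma> * (coroot \<theta> \<bullet> \<gamma>)) \<ge> 0" by simp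
  moreover have "(\<Sum>\<gamma>\<in>R. e \<gamma> * (coroot \<theta> \<bullet> \<gamma>)) = 2 * (\<Sum>\<gamma>\<in>Pos. e \<gamma> * (coroot \<theta> \<bullet> \<gamma>))"
    by (rule sum_roots_eq_twice_sum_pos) (simp add: e_def root_eps_uminus)
  moreover have "(\<Sum>\<gamma>\<in>Pos. e \<gamma> * (coroot \<theta> \<bullet> \<gamma>))
      = coroot \<theta> \<bullet> (\<Sum>\<gamma>\<in>Pos. eps (coroot \<gamma> \<bullet> l) *\<^sub>R \<gamma>)"
    by (simp add: inner_sum_right e_def root_eps_def)
  ultimately show ?thesis by simp
qed

lemma coroot_inner_tilde_ge:
  assumes "\<theta> \<in> R"
    and "\<And>\<gamma>. \<gamma> \<in> R \<Longrightarrow> coroot \<theta> \<bullet> \<gamma> > 0 \<Longrightarrow> root_eps l (root_refl \<theta> \<gamma>) = 1 \<Longrightarrow> root_eps l \<gamma> = 1"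
  shows "coroot \<theta> \<bullet> weight_tilde R n \<alpha> l \<ge> coroot \<theta> \<bullet> l"
proof -
  have "coroot \<theta> \<bullet> (\<Sum>\<gamma>\<in>Pos. eps (coroot \<gamma> \<bullet> l) *\<^sub>R \<gamma>) \<ge> 0"
    using assms by (rule coroot_inner_eps_sum_nonneg)
  then show ?thesis unfolding weight_tilde_def inner_add_right inner_scaleR_right by linarith
qed

section \<open>Positive affine coroots\<close>

definition pos_aff_coroots :: "(real \<times> 'a) set" where
  "pos_aff_coroots = {(r, coroot \<gamma>) | r \<gamma>. r \<in> \<int> \<and> \<gamma> \<in> R \<and> (r > 0 \<or> r = 0 \<and> \<gamma> \<in> Pos)}"

lemma pos_aff_coroot_nonneg:
  assumes "f \<in> pos_aff_coroots" "\<mu> \<in> minuscule_weights R n \<alpha>"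
  shows "aff_eval f \<mu> \<ge> 0"
proof -
  obtain r \<gamma> where f: "f = (r, coroot \<gamma>)" "r \<in> \<int>" "\<gamma> \<in> R" "r > 0 \<or> r = 0 \<and> \<gamma> \<in> Pos"
    using assms(1) by (auto simp: pos_aff_coroots_def)
  show ?thesis
  proof (cases "r > 0")
    case True
    obtain z where "r = real_of_int z" using f(2) by (auto elim: Ints_cases)
    \<comment> \<open>Integrality makes r large enough to absorb -1, the least possible pairing of a
      coroot with a weight in \<O>.\<close>
    then have "r \<ge> 1" using True by simp
    then show ?thesis
      using minuscule_pairing_bounds(1)[OF assms(2) f(3)] by (simp add: f(1) aff_eval_def)
  next
    case False
    then show ?thesis
      using f(4) minuscule_pairing_bounds(2)[OF assms(2) f(3)] by (simp add: f(1) aff_eval_def)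
  qed
qed

end

section \<open>The highest short root\<close>

locale highest_short_root_system = based_root_system +
  fixes \<beta> :: 'a
  assumes highest: "highest_short_root R n \<alpha> \<beta>"
begin

lemma beta_root: "\<beta> \<in> R"
  and beta_norm_le: "\<gamma> \<in> R \<Longrightarrow> norm \<beta> \<le> norm \<gamma>"
  and beta_highest: "\<gamma> \<in> short_roots R \<Longrightarrow> nonneg_comb n \<alpha> (\<beta> - \<gamma>)"
  using highest unfolding highest_short_root_def short_roots_def by auto

lemma beta_nonzero: "\<beta> \<noteq> 0"
  using beta_root root_nonzero by blast

lemma short_root_iff: "\<gamma> \<in> short_roots R \<longleftrightarrow> \<gamma> \<in> R \<and> norm \<gamma> = norm \<beta>"
proof
  assume "\<gamma> \<in> short_roots R"
  then have "\<gamma> \<in> R" "norm \<gamma> \<le> norm \<beta>" using beta_root by (auto simp: short_roots_def)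
  then show "\<gamma> \<in> R \<and> norm \<gamma> = norm \<beta>" using beta_norm_le by fastforce
next
  assume "\<gamma> \<in> R \<and> norm \<gamma> = norm \<beta>"
  then show "\<gamma> \<in> short_roots R" using beta_norm_le by (simp add: short_roots_def)
qed

lemma root_refl_beta_short: "\<gamma> \<in> R \<Longrightarrow> root_refl \<gamma> \<beta> \<in> short_roots R"
  using root_refl_root[of \<gamma> \<beta>] beta_root root_refl_inner_same[of \<gamma> \<beta>] root_nonzero[of \<gamma>]
  by (simp add: short_root_iff norm_eq_sqrt_inner)

text \<open>If - \<beta> were positive, comparing \<beta> with the short root - \<beta> would make 2
  \<beta> a nonnegative combination; adding - \<beta> would do the same for \<beta>.\<close>

lemma beta_pos: "\<beta> \<in> Pos"
proof (rule ccontr)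
  assume "\<beta> \<notin> Pos"
  then have "- \<beta> \<in> Pos" using not_pos_iff beta_root by blast
  then have neg: "nonneg_comb n \<alpha> (- \<beta>)" by (simp add: pos_roots_def)
  have "- \<beta> \<in> short_roots R" using beta_root uminus_root by (simp add: short_root_iff)
  then have "nonneg_comb n \<alpha> (\<beta> + \<beta>)" using beta_highest by fastforce
  then have "nonneg_comb n \<alpha> \<beta>" using nonneg_comb_add[OF _ neg] by fastforce
  then show False using neg nonneg_comb_antisym beta_nonzero by blast
qed

text \<open>With a pairing -m < 0, the reflected short root would be \<beta> + m \<gamma>, which is
  higher than \<beta>.\<close>

lemma beta_dominant:
  assumes "\<gamma> \<in> Pos"
  shows "coroot \<gamma> \<bullet> \<beta> \<ge> 0"
proof (rule ccontr)
  assume neg: "\<not> coroot \<gamma> \<bullet> \<beta> \<ge> 0"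
  have \<gamma>: "\<gamma> \<in> R" "nonneg_comb n \<alpha> \<gamma>" using assms by (auto simp: pos_roots_def)
  obtain k where k: "coroot \<gamma> \<bullet> \<beta> = real_of_int k"
    using coroot_inner_Ints[OF \<gamma>(1) beta_root] by (auto elim: Ints_cases)
  define m where "m = nat (- k)"
  have m: "coroot \<gamma> \<bullet> \<beta> = - real m" "m > 0" using neg k by (auto simp: m_def)
  have "nonneg_comb n \<alpha> (- (real m *\<^sub>R \<gamma>))"
    using beta_highest[OF root_refl_beta_short[OF \<gamma>(1)]] m by (simp add: root_refl_def)
  then have "real m *\<^sub>R \<gamma> = 0"
    using nonneg_comb_antisym nonneg_comb_mult[OF \<gamma>(2)] by blast
  then show False using m root_nonzero[OF \<gamma>(1)] by simp
qed

text \<open>As R is reduced, \<gamma> and \<beta> are not proportional, so Cauchy-Schwarz is strict.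
  Since \<beta> has minimal length, the integer pairing is then less than 2 in absolute
  value.\<close>

lemma coroot_inner_beta_cases:
  assumes \<gamma>: "\<gamma> \<in> R" "\<gamma> \<noteq> \<beta>" "\<gamma> \<noteq> - \<beta>"
  shows "coroot \<gamma> \<bullet> \<beta> \<in> {- 1, 0, 1}"
proof -
  have nz: "\<gamma> \<noteq> 0" using root_nonzero \<gamma> by blast
  have "\<bar>\<gamma> \<bullet> \<beta>\<bar> \<noteq> norm \<gamma> * norm \<beta>"
  proof
    assume "\<bar>\<gamma> \<bullet> \<beta>\<bar> = norm \<gamma> * norm \<beta>"
    then have "collinear {0, \<gamma>, \<beta>}" by (simp add: norm_cauchy_schwarz_equal)
    then obtain c where c: "\<beta> = c *\<^sub>R \<gamma>"
      using nz beta_nonzero by (auto simp: collinear_lemma)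
    then have "c = 1 \<or> c = - 1" using root_multiple[OF \<gamma>(1)] beta_root by metis
    then show False using c \<gamma> by auto
  qed
  then have "\<bar>\<gamma> \<bullet> \<beta>\<bar> < norm \<gamma> * norm \<beta>" using Cauchy_Schwarz_ineq2[of \<gamma> \<beta>] by linarith
  also have "\<dots> \<le> norm \<gamma> * norm \<gamma>" using beta_norm_le[OF \<gamma>(1)] by (simp add: mult_left_mono)
  also have "\<dots> = \<gamma> \<bullet> \<gamma>" by (simp add: norm_eq_sqrt_inner)
  finally have "\<bar>coroot \<gamma> \<bullet> \<beta>\<bar> < 2"
    using nz by (simp add: coroot_def abs_mult field_simps)
  moreover obtain k where "coroot \<gamma> \<bullet> \<beta> = real_of_int k"
    using coroot_inner_Ints[OF \<gamma>(1) beta_root] by (auto elim: Ints_cases)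
  ultimately have "\<bar>k\<bar> < 2" by linarith
  then have "k \<in> {-1,0,1}" by auto
  then show ?thesis using \<open>coroot \<gamma> \<bullet> \<beta> = real_of_int k\<close> by auto
qed

text \<open>With k the pairing of \<open>coroot \<beta>\<close> with \<eta>, the claim is that k
  \<beta> - \<eta> is a nonnegative combination; it comes from the maximality of \<beta> against
  \<eta> if k = 1, and against \<eta> - \<beta> otherwise.\<close>

lemma root_refl_beta_neg:
  assumes \<eta>: "\<eta> \<in> R" and one: "coroot \<eta> \<bullet> \<beta> = 1"
  shows "- root_refl \<beta> \<eta> \<in> Pos"
proof -
  have \<eta>0: "\<eta> \<noteq> 0" using root_nonzero \<eta> by blast
  obtain z where z: "coroot \<beta> \<bullet> \<eta> = real_of_int z"
    using coroot_inner_Ints[OF beta_root \<eta>] by (auto elim: Ints_cases)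
  have "coroot \<beta> \<bullet> \<eta> > 0"
    using coroot_inner_pos_iff[OF beta_nonzero \<eta>0] one by simp
  define k where "k = nat z"
  have k: "coroot \<beta> \<bullet> \<eta> = real k" "k > 0" using z \<open>coroot \<beta> \<bullet> \<eta> > 0\<close> by (auto simp: k_def)
  have "nonneg_comb n \<alpha> (real k *\<^sub>R \<beta> - \<eta>)"
  proof (cases "k = 1")
    case True
    \<comment> \<open>Both pairings are 1, so \<eta> and \<beta> have equal length.\<close>
    have "\<eta> \<bullet> \<eta> = 2 * (\<eta> \<bullet> \<beta>)" using one \<eta>0 by (simp add: coroot_def field_simps)
    also have "\<dots> = \<beta> \<bullet> \<beta>"
      using k True beta_nonzero by (simp add: coroot_def field_simps inner_commute)
    finally have "\<eta> \<in> short_roots R"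
      using \<eta> by (simp add: short_root_iff norm_eq_sqrt_inner)
    then show ?thesis using beta_highest True by simp
  next
    case False
    \<comment> \<open>Now k is at least 2, so the natural subtraction \<open>k - 2\<close> is exact,
      and k \<beta> - \<eta> splits as (2 \<beta> - \<eta>) + (k - 2) \<beta>.\<close>
    have "root_refl \<eta> \<beta> = \<beta> - \<eta>" using one by (simp add: root_refl_def)
    then have "\<beta> - \<eta> \<in> short_roots R" using root_refl_beta_short[OF \<eta>] by simp
    then have "- (\<beta> - \<eta>) \<in> short_roots R"
      using uminus_root by (metis short_root_iff norm_minus_cancel)
    then have "nonneg_comb n \<alpha> (\<beta> - - (\<beta> - \<eta>))" by (rule beta_highest)
    moreover have "nonneg_comb n \<alpha> (real (k - 2) *\<^sub>R \<beta>)"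
      using beta_pos by (intro nonneg_comb_mult) (simp add: pos_roots_def)
    ultimately have "nonneg_comb n \<alpha> ((\<beta> - - (\<beta> - \<eta>)) + real (k - 2) *\<^sub>R \<beta>)"
      by (rule nonneg_comb_add)
    moreover have "(\<beta> - - (\<beta> - \<eta>)) + real (k - 2) *\<^sub>R \<beta> = real k *\<^sub>R \<beta> - \<eta>"
      using False k(2) by (simp add: of_nat_diff algebra_simps scaleR_2)
    ultimately show ?thesis by metis
  qed
  moreover have "- root_refl \<beta> \<eta> = real k *\<^sub>R \<beta> - \<eta>" by (simp add: root_refl_def k)
  ultimately show ?thesis
    using uminus_root[OF root_refl_root[OF beta_root \<eta>]] by (simp add: pos_roots_def)
qed

section \<open>Simple affine reflections on positive affine coroots, and exchange\<close>

lemma aff_simple_0: "aff_simple \<alpha> \<beta> 0 = (1, coroot (- \<beta>))"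
  by (simp add: aff_simple_def aff_delta_def coroot_minus)

lemma aff_simple_pos: "i \<in> {1..n} \<Longrightarrow> aff_simple \<alpha> \<beta> i = (0, coroot (\<alpha> i))"
  by (simp add: aff_simple_def)

lemma aff_simple_pos_aff_coroot:
  assumes "i \<in> {0..n}"
  shows "aff_simple \<alpha> \<beta> i \<in> pos_aff_coroots"
proof (cases "i = 0")
  case True
  have "(1, coroot (- \<beta>)) \<in> pos_aff_coroots"
    unfolding pos_aff_coroots_def using uminus_root[OF beta_root] by force
  then show ?thesis using True aff_simple_0 by simp
next
  case False
  then have i: "i \<in> {1..n}" using assms by auto
  have "(0, coroot (\<alpha> i)) \<in> pos_aff_coroots"
    unfolding pos_aff_coroots_def using simple_root[OF i] simple_root_pos[OF i] by force
  then show ?thesis using aff_simple_pos[OF i] by simp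
qed

lemma snd_aff_simple_nonzero:
  assumes "i \<in> {0..n}"
  shows "snd (aff_simple \<alpha> \<beta> i) \<noteq> 0"
proof -
  have "coroot \<gamma> \<noteq> 0" if "\<gamma> \<in> R" for \<gamma> using root_nonzero[OF that] by (simp add: coroot_def)
  then show ?thesis using aff_simple_pos_aff_coroot[OF assms] by (auto simp: pos_aff_coroots_def)
qed

lemma aff_refl_fun_coroot:
  assumes "\<theta> \<noteq> 0"
  shows "aff_refl_fun (c, coroot \<theta>) (r, coroot \<gamma>)
    = (r - (coroot \<gamma> \<bullet> \<theta>) * c, coroot (root_refl \<theta> \<gamma>))"
  using assms by (simp add: aff_refl_fun_def coroot_coroot coroot_root_refl)

lemma root_refl_minus: "root_refl (- \<theta>) x = root_refl \<theta> x"
  by (simp add: root_refl_def coroot_minus)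

text \<open>For i >= 1 the constant r stays, and \<open>simple_refl_pos_root\<close> settles r = 0.
  For i = 0 it grows by \<open>coroot \<gamma> \<bullet> \<beta>\<close>; only negative pairings are
  critical, namely -2 for \<gamma> = - \<beta> and otherwise -1.\<close>

lemma aff_refl_fun_pos:
  assumes i: "i \<in> {0..n}" and f: "f \<in> pos_aff_coroots" "f \<noteq> aff_simple \<alpha> \<beta> i"
  shows "aff_refl_fun (aff_simple \<alpha> \<beta> i) f \<in> pos_aff_coroots"
proof -
  obtain r \<gamma> where r: "f = (r, coroot \<gamma>)" "r \<in> \<int>" "\<gamma> \<in> R" "r > 0 \<or> r = 0 \<and> \<gamma> \<in> Pos"
    using f(1) by (auto simp: pos_aff_coroots_def)
  show ?thesis
  proof (cases "i = 0")
    case False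
    then have i: "i \<in> {1..n}" using i by auto
    have "\<gamma> \<noteq> \<alpha> i" if "r = 0" using f(2) r(1) aff_simple_pos[OF i] that by auto
    then have "r > 0 \<or> r = 0 \<and> root_refl (\<alpha> i) \<gamma> \<in> Pos"
      using r(4) simple_refl_pos_root[OF i] by blast
    moreover have "root_refl (\<alpha> i) \<gamma> \<in> R" using simple_root[OF i] r(3) root_refl_root by blast
    ultimately show ?thesis
      using aff_refl_fun_coroot[OF root_nonzero[OF simple_root[OF i]], of 0 r \<gamma>] r
      by (auto simp: aff_simple_pos[OF i] pos_aff_coroots_def)
  next
    case True
    define \<gamma>' where "\<gamma>' = root_refl \<beta> \<gamma>"
    define r' where "r' = r + coroot \<gamma> \<bullet> \<beta>"
    have eq: "aff_refl_fun (aff_simple \<alpha> \<beta> i) f = (r', coroot \<gamma>')"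
      using True aff_refl_fun_coroot[of "- \<beta>" 1 r \<gamma>] beta_nonzero r(1)
      by (simp add: aff_simple_0 root_refl_minus \<gamma>'_def r'_def)
    have "r' \<in> \<int>" using r coroot_inner_Ints[OF r(3) beta_root] by (simp add: r'_def)
    moreover have "\<gamma>' \<in> R" using root_refl_root[OF beta_root r(3)] by (simp add: \<gamma>'_def)
    moreover have "r' > 0 \<or> r' = 0 \<and> \<gamma>' \<in> Pos"
    proof -
      have rnn: "r \<ge> 0" using r(4) by auto
      obtain z where z: "r = real_of_int z" using r(2) by (auto elim: Ints_cases)
      consider "\<gamma> = \<beta>" | "\<gamma> = - \<beta>" | "\<gamma> \<noteq> \<beta>" "\<gamma> \<noteq> - \<beta>" by blast
      then show ?thesis
      proof cases
        case 1
        then show ?thesis using rnn beta_nonzero by (simp add: r'_def coroot_inner_self)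
      next
        case 2
        \<comment> \<open>r = 1 would make f the excluded affine simple coroot, and r = 0 would need
          - \<beta> to be positive.\<close>
        have "r \<noteq> 1" using f(2) r(1) True 2 aff_simple_0 by auto
        moreover have "r \<noteq> 0" using r(4) 2 beta_pos not_pos_iff[OF beta_root] by auto
        ultimately have "r \<ge> 2" using rnn z by auto
        moreover have "\<gamma>' = \<beta>"
          using 2 beta_nonzero
          by (simp add: \<gamma>'_def root_refl_def coroot_inner_self scaleR_2)
        moreover have "r' = r - 2"
          using 2 beta_nonzero by (simp add: r'_def coroot_minus coroot_inner_self)
        ultimately show ?thesis using beta_pos by auto
      next
        case 3
        then consider "coroot \<gamma> \<bullet> \<beta> = 1" | "coroot \<gamma> \<bullet> \<beta> = 0" | "coroot \<gamma> \<bullet> \<beta> = - 1"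
          using coroot_inner_beta_cases[OF r(3)] by auto
        then show ?thesis
        proof cases
          case 1
          then show ?thesis using rnn by (simp add: r'_def)
        next
          case 2
          then have "coroot \<beta> \<bullet> \<gamma> = 0"
            using root_nonzero[OF r(3)] by (simp add: coroot_def inner_commute)
          then show ?thesis using 2 r(4) by (simp add: r'_def \<gamma>'_def root_refl_def)
        next
          case 3
          \<comment> \<open>Dominance of \<beta> excludes a positive \<gamma>, so r is at least 1;
            if r drops to 0, the reflected root is positive.\<close>
          have "r \<noteq> 0" using r(4) beta_dominant[of \<gamma>] 3 by auto
          then have "r \<ge> 1" using rnn z by auto
          have "- root_refl \<beta> (- \<gamma>) \<in> Pos"
            using root_refl_beta_neg[of "- \<gamma>"] uminus_root[OF r(3)] 3
            by (simp add: coroot_minus)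
          then have "\<gamma>' \<in> Pos" by (simp add: \<gamma>'_def root_refl_def)
          then show ?thesis using \<open>r \<ge> 1\<close> 3 by (auto simp: r'_def)
        qed
      qed
    qed
    ultimately show ?thesis unfolding eq pos_aff_coroots_def by blast
  qed
qed

text \<open>Reflecting x in a wall that has x on its nonpositive side costs no extra letters on the
  way to \<O>. The induction strips the last letter, which acts first, and moves the wall along with
  the point.\<close>

lemma exchange:
  assumes "set u \<subseteq> {0..n}" "f \<in> pos_aff_coroots" "aff_eval f x \<le> 0"
    "word_map \<alpha> \<beta> u x \<in> minuscule_weights R n \<alpha>"
  shows "\<exists>v. set v \<subseteq> {0..n} \<and> length v \<le> length u \<and>
    word_map \<alpha> \<beta> v (aff_reflection f x) = word_map \<alpha> \<beta> u x"
  using assms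
proof (induction u arbitrary: f x rule: rev_induct)
  case Nil
  \<comment> \<open>The point already lies in \<O>, where f is nonnegative, so it is on the wall and
    stays fixed.\<close>
  then have "aff_eval f x = 0"
    using pos_aff_coroot_nonneg[OF Nil(2), of x] by (simp add: word_map_Nil)
  then have "aff_reflection f x = x" by (simp add: aff_reflection_def)
  then show ?case by auto
next
  case (snoc q u)
  let ?a = "aff_simple \<alpha> \<beta> q"
  have q: "q \<in> {0..n}" and u: "set u \<subseteq> {0..n}" using snoc.prems(1) by auto
  note nz = snd_aff_simple_nonzero[OF q]
  have step: "word_map \<alpha> \<beta> (u @ [q]) x = word_map \<alpha> \<beta> u (aff_reflection ?a x)" for u x
    by (simp add: word_map_append word_map_Cons word_map_Nil simple_refl_def)
  show ?case
  proof (cases "f = ?a")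
    \<comment> \<open>The reflection in f is the letter q itself, so it cancels that letter.\<close>
    case True
    then show ?thesis using u step by (intro exI[of _ u]) auto
  next
    case False
    have "aff_eval (aff_refl_fun ?a f) (aff_reflection ?a x) \<le> 0"
      using snoc.prems(3) nz by (simp add: aff_eval_refl_fun aff_reflection_invol)
    then obtain v where v: "set v \<subseteq> {0..n}" "length v \<le> length u"
      "word_map \<alpha> \<beta> v (aff_reflection (aff_refl_fun ?a f) (aff_reflection ?a x))
        = word_map \<alpha> \<beta> u (aff_reflection ?a x)"
      using snoc.IH[OF u aff_refl_fun_pos[OF q snoc.prems(2) False], of "aff_reflection ?a x"]
        snoc.prems(4) step by auto
    then have "word_map \<alpha> \<beta> (v @ [q]) (aff_reflection f x) = word_map \<alpha> \<beta> (u @ [q]) x"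
      using nz by (simp add: step aff_reflection_conj)
    then show ?thesis using v q by (intro exI[of _ "v @ [q]"]) auto
  qed
qed

section \<open>Positivity along a shortest word\<close>

lemma simple_refl_invol:
  "i \<in> {0..n} \<Longrightarrow> simple_refl \<alpha> \<beta> i (simple_refl \<alpha> \<beta> i x) = x"
  by (simp add: simple_refl_def aff_reflection_invol snd_aff_simple_nonzero)

lemma word_map_rev:
  "set u \<subseteq> {0..n} \<Longrightarrow> word_map \<alpha> \<beta> (rev u) (word_map \<alpha> \<beta> u x) = x"
  by (induction u arbitrary: x)
    (simp_all add: word_map_append word_map_Cons word_map_Nil simple_refl_invol)

lemma simple_refl_weight:
  assumes "i \<in> {0..n}" "l \<in> weight_lattice R"
  shows "simple_refl \<alpha> \<beta> i l \<in> weight_lattice R"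
proof -
  \<comment> \<open>c = 1 serves the affine reflection, c = 0 the linear ones.\<close>
  have refl: "l - (coroot \<theta> \<bullet> l - c) *\<^sub>R \<theta> \<in> weight_lattice R" if "\<theta> \<in> R" "c \<in> \<int>" for \<theta> c
    using assms(2) that coroot_inner_Ints
    by (auto simp: weight_lattice_def inner_diff_right)
  show ?thesis
  proof (cases "i = 0")
    case True
    then show ?thesis using refl[OF beta_root, of 1] beta_nonzero by (simp add: simple_refl_0)
  next
    case False
    then have "\<alpha> i \<in> R" using assms(1) simple_root by auto
    then show ?thesis
      using refl[of "\<alpha> i" 0] False root_nonzero[of "\<alpha> i"] by (simp add: simple_refl_pos)
  qed
qed

lemma word_map_weight:
  "set u \<subseteq> {0..n} \<Longrightarrow> l \<in> weight_lattice R \<Longrightarrow> word_map \<alpha> \<beta> u l \<in> weight_lattice R"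
  by (induction u) (simp_all add: word_map_Cons word_map_Nil simple_refl_weight)

text \<open>The shift cannot lower the value, by \<open>coroot_inner_tilde_ge\<close>, once
  \<open>root_eps l\<close> is monotone under the reflection. For i >= 1 the pairing with l strictly
  drops under it; for i = 0 it may stay equal, and ties need the sign convention.\<close>

lemma aff_simple_tilde_pos:
  assumes i: "i \<in> {0..n}" and l: "l \<in> weight_lattice R"
    and pos: "aff_eval (aff_simple \<alpha> \<beta> i) l > 0"
  shows "aff_eval (aff_simple \<alpha> \<beta> i) (weight_tilde R n \<alpha> l) > 0"
proof (cases "i = 0")
  case False
  then have i: "i \<in> {1..n}" using i by auto
  have \<theta>: "\<alpha> i \<in> R" "\<alpha> i \<noteq> 0" using simple_root[OF i] root_nonzero by auto
  have c: "coroot (\<alpha> i) \<bullet> l > 0" using pos aff_simple_pos[OF i] by (simp add: aff_eval_def)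
  have "coroot (\<alpha> i) \<bullet> weight_tilde R n \<alpha> l \<ge> coroot (\<alpha> i) \<bullet> l"
  proof (rule coroot_inner_tilde_ge[OF \<theta>(1)])
    fix \<gamma> assume \<gamma>: "\<gamma> \<in> R" "coroot (\<alpha> i) \<bullet> \<gamma> > 0" "root_eps l (root_refl (\<alpha> i) \<gamma>) = 1"
    have "coroot \<gamma> \<bullet> \<alpha> i > 0"
      using coroot_inner_pos_iff[OF \<theta>(2) root_nonzero[OF \<gamma>(1)]] \<gamma>(2) by simp
    then have "coroot (root_refl (\<alpha> i) \<gamma>) \<bullet> l < coroot \<gamma> \<bullet> l"
      using c \<theta> by (simp add: coroot_root_refl inner_diff_left)
    then show "root_eps l \<gamma> = 1" using \<gamma>(3) by (auto simp: root_eps_eq_1_iff)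
  qed
  then show ?thesis using c aff_simple_pos[OF i] by (simp add: aff_eval_def)
next
  case True
  have c: "coroot \<beta> \<bullet> l < 1"
    using pos True by (simp add: aff_simple_0 aff_eval_def coroot_minus)
  moreover have "coroot \<beta> \<bullet> l \<in> \<int>" using l beta_root by (simp add: weight_lattice_def)
  \<comment> \<open>Integrality of the weight improves < 1 to \<le> 0, which fixes the sign of the
    change under the reflection.\<close>
  ultimately have c0: "coroot \<beta> \<bullet> l \<le> 0" by (auto elim!: Ints_cases)
  have "coroot (- \<beta>) \<bullet> weight_tilde R n \<alpha> l \<ge> coroot (- \<beta>) \<bullet> l"
  proof (rule coroot_inner_tilde_ge[OF uminus_root[OF beta_root]])
    fix \<gamma> assume \<gamma>: "\<gamma> \<in> R" "coroot (- \<beta>) \<bullet> \<gamma> > 0" "root_eps l (root_refl (- \<beta>) \<gamma>) = 1"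
    let ?\<gamma>' = "root_refl \<beta> \<gamma>"
    have \<gamma>': "?\<gamma>' \<in> R" "?\<gamma>' \<noteq> 0" using root_refl_root[OF beta_root \<gamma>(1)] root_nonzero by auto
    have "coroot \<gamma> \<bullet> (- \<beta>) > 0"
      using coroot_inner_pos_iff[of "- \<beta>" \<gamma>] root_nonzero[OF \<gamma>(1)] beta_nonzero \<gamma>(2) by simp
    then have "(coroot \<gamma> \<bullet> \<beta>) * (coroot \<beta> \<bullet> l) \<ge> 0"
      using c0 by (simp add: mult_nonpos_nonpos)
    then have le: "coroot ?\<gamma>' \<bullet> l \<le> coroot \<gamma> \<bullet> l"
      using beta_nonzero by (simp add: coroot_root_refl inner_diff_left)
    have "coroot \<beta> \<bullet> ?\<gamma>' > 0"
      using \<gamma>(2) beta_nonzero by (simp add: coroot_inner_root_refl coroot_minus)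
    then have "coroot ?\<gamma>' \<bullet> \<beta> > 0" using coroot_inner_pos_iff beta_nonzero \<gamma>'(2) by blast
    \<comment> \<open>A positive root orthogonal to l has sign -1, so sign 1 at
      \<open>?\<gamma>'\<close> means a strictly positive pairing, which passes to \<gamma>.\<close>
    then have "?\<gamma>' \<in> Pos"
      using beta_dominant[of "- ?\<gamma>'"] not_pos_iff[OF \<gamma>'(1)] by (force simp: coroot_minus)
    then show "root_eps l \<gamma> = 1"
      using \<gamma>(3) le by (auto simp: root_eps_eq_1_iff root_refl_minus)
  qed
  then show ?thesis using True c by (simp add: aff_simple_0 aff_eval_def coroot_minus)
qed

text \<open>Turns minimality among group elements into minimality among words, since
  \<open>exchange\<close> yields words that need not be reduced.\<close>

lemma shortest_length_le:
  assumes w: "shortest_to_minuscule R n \<alpha> \<beta> l w" and r: "reduced_expression n \<alpha> \<beta> is w"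
    and u: "set u \<subseteq> {0..n}" "word_map \<alpha> \<beta> u l \<in> minuscule_weights R n \<alpha>"
  shows "length is \<le> length u"
proof -
  have "length is = weyl_length n \<alpha> \<beta> w" using r by (simp add: reduced_expression_def)
  also have "\<dots> \<le> weyl_length n \<alpha> \<beta> (word_map \<alpha> \<beta> u)"
    using w u unfolding shortest_to_minuscule_def dual_affine_weyl_def by blast
  also have "\<dots> \<le> length u"
    unfolding weyl_length_def using u(1) by (intro Least_le) blast
  finally show ?thesis .
qed

text \<open>The path starts at the end point and undoes letters from the left, leaving a suffix
  acting on l. The index j is \<open>Suc k\<close>, with k a list position.\<close>

lemma step_weight_eq:
  assumes "set is \<subseteq> {0..n}"
  shows "step_weight \<alpha> \<beta> is (word_map \<alpha> \<beta> is l) (Suc k) = word_map \<alpha> \<beta> (drop k is) l"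
proof -
  have "word_map \<alpha> \<beta> is l = word_map \<alpha> \<beta> (take k is) (word_map \<alpha> \<beta> (drop k is) l)"
    by (simp flip: word_map_append)
  moreover have "set (take k is) \<subseteq> {0..n}" using assms set_take_subset by fastforce
  ultimately show ?thesis by (simp add: step_weight_def word_map_rev)
qed

text \<open>At a nonpositive value, \<open>exchange\<close> applied to the prefix before position k
  would allow the letter at k to be dropped, giving a shorter word from l into \<O>.\<close>

lemma step_positive:
  assumes w: "shortest_to_minuscule R n \<alpha> \<beta> l w" and r: "reduced_expression n \<alpha> \<beta> is w"
    and k: "k < length is"
  shows "aff_eval (aff_simple \<alpha> \<beta> (is ! k)) (word_map \<alpha> \<beta> (drop k is) l) > 0"
proof (rule ccontr)
  let ?x = "word_map \<alpha> \<beta> (drop k is) l" and ?a = "aff_simple \<alpha> \<beta> (is ! k)"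
  assume "\<not> ?thesis"
  then have neg: "aff_eval ?a ?x \<le> 0" by simp
  have "is": "set is \<subseteq> {0..n}" "word_map \<alpha> \<beta> is = w"
    using r by (auto simp: reduced_expression_def)
  have i: "is ! k \<in> {0..n}" using "is"(1) k nth_mem by blast
  have sets: "set (take k is) \<subseteq> {0..n}" "set (drop (Suc k) is) \<subseteq> {0..n}"
    using "is"(1) set_take_subset set_drop_subset by fastforce+
  have "word_map \<alpha> \<beta> (take k is) ?x = w l"
    using "is"(2) by (simp flip: word_map_append)
  moreover have "w l \<in> minuscule_weights R n \<alpha>" using w by (simp add: shortest_to_minuscule_def)
  ultimately obtain v where v: "set v \<subseteq> {0..n}" "length v \<le> length (take k is)"
    "word_map \<alpha> \<beta> v (aff_reflection ?a ?x) \<in> minuscule_weights R n \<alpha>"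
    using exchange[OF sets(1) aff_simple_pos_aff_coroot[OF i] neg] by auto
  have "?x = simple_refl \<alpha> \<beta> (is ! k) (word_map \<alpha> \<beta> (drop (Suc k) is) l)"
    using k by (simp flip: Cons_nth_drop_Suc add: word_map_Cons)
  \<comment> \<open>Reflecting undoes the letter at k, leaving the suffix after it.\<close>
  then have "aff_reflection ?a ?x = word_map \<alpha> \<beta> (drop (Suc k) is) l"
    using simple_refl_invol[OF i] by (simp add: simple_refl_def)
  then have "word_map \<alpha> \<beta> (v @ drop (Suc k) is) l \<in> minuscule_weights R n \<alpha>"
    using v(3) by (simp add: word_map_append)
  then have "length is \<le> length (v @ drop (Suc k) is)"
    using v(1) sets(2) by (intro shortest_length_le[OF w r]) auto
  then show False using v(2) k by simp
qed

lemma step_const_pos: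
  assumes w: "shortest_to_minuscule R n \<alpha> \<beta> l w" and r: "reduced_expression n \<alpha> \<beta> is w"
    and l: "l \<in> weight_lattice R" and k: "k < length is"
  shows "step_const R n \<alpha> \<beta> is (w l) (Suc k) > 0"
proof -
  have "is": "set is \<subseteq> {0..n}" "word_map \<alpha> \<beta> is = w"
    using r by (auto simp: reduced_expression_def)
  have "is ! k \<in> {0..n}" using "is"(1) k nth_mem by blast
  moreover have "set (drop k is) \<subseteq> {0..n}" using "is"(1) set_drop_subset by fastforce
  ultimately have "aff_eval (aff_simple \<alpha> \<beta> (is ! k))
      (weight_tilde R n \<alpha> (word_map \<alpha> \<beta> (drop k is) l)) > 0"
    using aff_simple_tilde_pos word_map_weight l step_positive[OF w r k] by blast
  then show ?thesis
    using step_weight_eq[OF "is"(1), of l k] "is"(2) by (simp add: step_const_def)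
qed

end

theorem corollary6p2:
  fixes R :: "'a::euclidean_space set"
    and n :: nat
    and \<alpha> :: "nat \<Rightarrow> 'a"
    and \<beta> l :: 'a
    and w :: "'a \<Rightarrow> 'a"
    and "is" :: "nat list"
  assumes "irreducible_root_system R"
    and "simple_roots R n \<alpha>"
    and "highest_short_root R n \<alpha> \<beta>"
    and "l \<in> dominant_weights R n \<alpha>"
    and "shortest_to_minuscule R n \<alpha> \<beta> l w"
    and "reduced_expression n \<alpha> \<beta> is w"
  shows "(\<forall>j\<in>{1..length is}. step_const R n \<alpha> \<beta> is (w l) j > 0) \<and>
    (\<forall>J. J \<subseteq> {1..length is} \<longrightarrow> (\<Prod>j\<in>J. step_const R n \<alpha> \<beta> is (w l) j) > 0)"
proof -
  interpret highest_short_root_system R n \<alpha> \<beta>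
    using assms(1-3) by unfold_locales (auto simp: irreducible_root_system_def)
  have l: "l \<in> weight_lattice R" using assms(4) by (simp add: dominant_weights_def)
  have "step_const R n \<alpha> \<beta> is (w l) j > 0" if "j \<in> {1..length is}" for j
    using step_const_pos[OF assms(5,6) l, of "j - 1"] that by auto
  then show ?thesis by (auto intro!: prod_pos)
qed

end
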